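(* Let $(A,B,\beta,T)$ and $(K,L,\alpha,S)$ be relative Rota-Baxter groups. Any semi-direct product of $(A,B,\beta,T)$ by $(K,L,\alpha,S)$ gives rise (via $k\mapsto(1,k)$, $l\mapsto(1,l)$ and $(a,k)\mapsto a$, $(b,l)\mapsto b$) to a split-extension of $(A,B,\beta,T)$ by $(K,L,\alpha,S)$. Furthermore, any split-extension of $(A,B,\beta,T)$ by $(K,L,\alpha,S)$ is equivalent to an extension defined by a semi-direct product of $(A,B,\beta,T)$ by $(K,L,\alpha,S)$.
   Context: A relative Rota-Baxter group is a quadruple $(H,G,\phi,R)$ with $H,G$ groups, $\phi:G\to\operatorname{Aut}(H)$, $g\mapsto\phi_g$, a homomorphism, and $R:H\to G$ a map with $R(h_1)R(h_2)=R(h_1\phi_{R(h_1)}(h_2))$ for all $h_1,h_2\in H$. A homomorphism $(\psi,\eta):(H,G,\phi,R)\to(H',G',\phi',R')$ is a pair of group homomorphisms $\psi:H\to H'$, $\eta:G\to G'$ with $\eta R=R'\psi$ and $\psi\phi_g=\phi'_{\eta(g)}\psi$ for all $g\in G$; it is an isomorphism (embedding, epimorphism) if both components are bijective (injective, surjective). An extension of $(A,B,\beta,T)$ by $(K,L,\alpha,S)$ is a relative Rota-Baxter group $(H,G,\phi,R)$ with an embedding $(i_1,i_2):(K,L,\alpha,S)\to(H,G,\phi,R)$ and an epimorphism $(\pi_1,\pi_2):(H,G,\phi,R)\to(A,B,\beta,T)$ such that $\operatorname{im}(i_j)=\ker(\pi_j)$ for $j=1,2$. (No commutativity or triviality is assumed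 here.) Two extensions are equivalent if there is an isomorphism $(\eta,\zeta)$ of the middle terms with $\eta i_1=i_1'$, $\zeta i_2=i_2'$, $\pi_1'\eta=\pi_1$, $\pi_2'\zeta=\pi_2$. The extension is a split-extension if there are $s_H:A\to H$, $s_G:B\to G$ with $\pi_1s_H=\mathrm{id}_A$, $\pi_2s_G=\mathrm{id}_B$ such that $(s_H,s_G)$ is a homomorphism of relative Rota-Baxter groups from $(A,B,\beta,T)$ to $(H,G,\phi,R)$. Semi-direct product: suppose given a map $f:L\times A\to K$, a homomorphism $\nu:B\to\operatorname{Aut}(K)$ and anti-homomorphisms $\mu:A\to\operatorname{Aut}(K)$, $\sigma:B\to\operatorname{Aut}(L)$ such that for all $a_i\in A$, $b\in B$, $k_i\in K$, $l,l_i\in L$: (i) $\nu_b\big(f(\sigma_b(l_1)l_2,a_1)\,\alpha_{\sigma_b(l_1)l_2}(k_1)\big)=f(l_1,\beta_b(a_1))\,\alpha_{l_1}\big(\nu_b(f(l_2,a_1)\alpha_{l_2}(k_1))\big)$; (ii) $\nu_b\big(f(l,a_1a_2)\,\alpha_l(\mu_{a_2}(k_1)k_2)\big)=\mu_{\beta_b(a_2)}\big(\nu_b(f(l,a_1)\alpha_l(k_1))\big)\,\nu_b(f(l,a_2)\alpha_l(k_2))$; (iii) $\sigma_{T(a_2)}(S(\nu^{-1}_{T(a_1)}(k_1)))\,S(\nu^{-1}_{T(a_2)}(k_2))=S\big(\nu^{-1}_{T(a_1)T(a_2)}\big(\mu_{\beta_{T(a_1)}(a_2)}(k_1)\,\nu_{T(a_1)}\big(f(S(\nu^{-1}_{T(a_1)}(k_1)),a_2)\,\alpha_{S(\nu^{-1}_{T(a_1)}(k_1))}(k_2)\big)\big)\big)$.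 Let $A\ltimes_\mu K$ be the set $A\times K$ with $(a_1,k_1)(a_2,k_2)=(a_1a_2,\mu_{a_2}(k_1)k_2)$ and $B\ltimes_\sigma L$ the set $B\times L$ with $(b_1,l_1)(b_2,l_2)=(b_1b_2,\sigma_{b_2}(l_1)l_2)$. Then $(A\ltimes_\mu K,B\ltimes_\sigma L,\phi,R)$ with $\phi_{(b,l)}(a,k)=(\beta_b(a),\nu_b(f(l,a)\alpha_l(k)))$ and $R(a,k)=(T(a),S(\nu^{-1}_{T(a)}(k)))$ is a relative Rota-Baxter group, called the semi-direct product of $(A,B,\beta,T)$ by $(K,L,\alpha,S)$ with respect to $(\nu,\mu,\sigma,f)$. *)

theory Defs
  imports "HOL-Algebra.Coset" "HOL-Algebra.Bij"
begin

text \<open>The order of the arguments is that of the quadruple \<open>(H, G, \<phi>, R)\<close>. Automorphisms are elements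
  of the library group \<open>AutoGroup H\<close>, hence extensional functions on \<open>carrier H\<close>.\<close>

locale rel_rota_baxter_group = H: group H + G: group G
  for H :: "('h, 'm) monoid_scheme" and G :: "('g, 'n) monoid_scheme" +
  fixes \<phi> :: "'g \<Rightarrow> 'h \<Rightarrow> 'h" and R :: "'h \<Rightarrow> 'g"
  assumes action_hom: "\<phi> \<in> hom G (AutoGroup H)"
    and R_closed: "R \<in> carrier H \<rightarrow> carrier G"
    and R_mult: "\<lbrakk>h1 \<in> carrier H; h2 \<in> carrier H\<rbrakk>
      \<Longrightarrow> R h1 \<otimes>\<^bsub>G\<^esub> R h2 = R (h1 \<otimes>\<^bsub>H\<^esub> \<phi> (R h1) h2)"

locale rel_rota_baxter_hom =
  source: rel_rota_baxter_group H G \<phi> R + target: rel_rota_baxter_group H' G' \<phi>' R'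
  for H :: "('h, 'm) monoid_scheme" and G :: "('g, 'n) monoid_scheme" and \<phi> R
    and H' :: "('h', 'm') monoid_scheme" and G' :: "('g', 'n') monoid_scheme" and \<phi>' R' +
  fixes \<psi> :: "'h \<Rightarrow> 'h'" and \<eta> :: "'g \<Rightarrow> 'g'"
  assumes \<psi>_hom: "\<psi> \<in> hom H H'"
    and \<eta>_hom: "\<eta> \<in> hom G G'"
    and R_commute: "h \<in> carrier H \<Longrightarrow> \<eta> (R h) = R' (\<psi> h)"
    and action_commute: "\<lbrakk>g \<in> carrier G; h \<in> carrier H\<rbrakk> \<Longrightarrow> \<psi> (\<phi> g h) = \<phi>' (\<eta> g) (\<psi> h)"

locale rel_rota_baxter_embedding = rel_rota_baxter_hom +
  assumes \<psi>_inj: "inj_on \<psi> (carrier H)"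
    and \<eta>_inj: "inj_on \<eta> (carrier G)"

locale rel_rota_baxter_epimorphism = rel_rota_baxter_hom +
  assumes \<psi>_surj: "\<psi> ` carrier H = carrier H'"
    and \<eta>_surj: "\<eta> ` carrier G = carrier G'"

locale rel_rota_baxter_iso = rel_rota_baxter_hom +
  assumes \<psi>_bij: "bij_betw \<psi> (carrier H) (carrier H')"
    and \<eta>_bij: "bij_betw \<eta> (carrier G) (carrier G')"

text \<open>Extensions of \<open>(A, B, \<beta>, T)\<close> by \<open>(K, L, \<alpha>, S)\<close>, with middle term \<open>(H, G, \<phi>, R)\<close>.\<close>

locale rel_rota_baxter_extension =
  embedding: rel_rota_baxter_embedding K L \<alpha> S H G \<phi> R i1 i2 +
  projection: rel_rota_baxter_epimorphism H G \<phi> R A B \<beta> T p1 p2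
  for A :: "('a, 'ma) monoid_scheme" and B :: "('b, 'mb) monoid_scheme" and \<beta> T
    and K :: "('k, 'mk) monoid_scheme" and L :: "('l, 'ml) monoid_scheme" and \<alpha> S
    and H :: "('h, 'mh) monoid_scheme" and G :: "('g, 'mg) monoid_scheme" and \<phi> R
    and i1 i2 p1 p2 +
  assumes exact1: "i1 ` carrier K = kernel H A p1"
    and exact2: "i2 ` carrier L = kernel G B p2"

locale rel_rota_baxter_split_extension = rel_rota_baxter_extension +
  assumes split: "\<exists>sH sG. rel_rota_baxter_hom A B \<beta> T H G \<phi> R sH sG \<and>
      (\<forall>a \<in> carrier A. p1 (sH a) = a) \<and> (\<forall>b \<in> carrier B. p2 (sG b) = b)"

locale rel_rota_baxter_extension_pair =
  first: rel_rota_baxter_extension A B \<beta> T K L \<alpha> S H G \<phi> R i1 i2 p1 p2 +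
  second: rel_rota_baxter_extension A B \<beta> T K L \<alpha> S H' G' \<phi>' R' i1' i2' p1' p2'
  for A :: "('a, 'ma) monoid_scheme" and B :: "('b, 'mb) monoid_scheme" and \<beta> T
    and K :: "('k, 'mk) monoid_scheme" and L :: "('l, 'ml) monoid_scheme" and \<alpha> S
    and H :: "('h, 'mh) monoid_scheme" and G :: "('g, 'mg) monoid_scheme" and \<phi> R
    and i1 i2 p1 p2
    and H' :: "('h', 'mh') monoid_scheme" and G' :: "('g', 'mg') monoid_scheme" and \<phi>' R'
    and i1' i2' p1' p2'

locale rel_rota_baxter_equivalent_extensions = rel_rota_baxter_extension_pair +
  assumes equivalent: "\<exists>\<eta> \<zeta>. rel_rota_baxter_iso H G \<phi> R H' G' \<phi>' R' \<eta> \<zeta> \<and>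
      (\<forall>k \<in> carrier K. \<eta> (i1 k) = i1' k) \<and>
      (\<forall>l \<in> carrier L. \<zeta> (i2 l) = i2' l) \<and>
      (\<forall>h \<in> carrier H. p1' (\<eta> h) = p1 h) \<and>
      (\<forall>g \<in> carrier G. p2' (\<zeta> g) = p2 g)"

definition anti_hom :: "('a, 'm) monoid_scheme \<Rightarrow> ('b, 'n) monoid_scheme \<Rightarrow> ('a \<Rightarrow> 'b) set"
  where "anti_hom G H =
    {h \<in> carrier G \<rightarrow> carrier H.
      \<forall>x \<in> carrier G. \<forall>y \<in> carrier G. h (x \<otimes>\<^bsub>G\<^esub> y) = h y \<otimes>\<^bsub>H\<^esub> h x}"

locale rel_rota_baxter_semidirect_data =
  base: rel_rota_baxter_group A B \<beta> T + fibre: rel_rota_baxter_group K L \<alpha> S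
  for A :: "('a, 'ma) monoid_scheme" and B :: "('b, 'mb) monoid_scheme" and \<beta> T
    and K :: "('k, 'mk) monoid_scheme" and L :: "('l, 'ml) monoid_scheme" and \<alpha> S +
  fixes \<nu> :: "'b \<Rightarrow> 'k \<Rightarrow> 'k" and \<mu> :: "'a \<Rightarrow> 'k \<Rightarrow> 'k"
    and \<sigma> :: "'b \<Rightarrow> 'l \<Rightarrow> 'l" and f :: "'l \<Rightarrow> 'a \<Rightarrow> 'k"
  assumes \<nu>_hom: "\<nu> \<in> hom B (AutoGroup K)"
    and \<mu>_anti_hom: "\<mu> \<in> anti_hom A (AutoGroup K)"
    and \<sigma>_anti_hom: "\<sigma> \<in> anti_hom B (AutoGroup L)"
    and f_closed: "f \<in> carrier L \<rightarrow> carrier A \<rightarrow> carrier K"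
    and cond_i: "\<lbrakk>b \<in> carrier B; l1 \<in> carrier L; l2 \<in> carrier L; a1 \<in> carrier A; k1 \<in> carrier K\<rbrakk> \<Longrightarrow>
      \<nu> b (f (\<sigma> b l1 \<otimes>\<^bsub>L\<^esub> l2) a1 \<otimes>\<^bsub>K\<^esub> \<alpha> (\<sigma> b l1 \<otimes>\<^bsub>L\<^esub> l2) k1)
      = f l1 (\<beta> b a1) \<otimes>\<^bsub>K\<^esub> \<alpha> l1 (\<nu> b (f l2 a1 \<otimes>\<^bsub>K\<^esub> \<alpha> l2 k1))"
    and cond_ii: "\<lbrakk>b \<in> carrier B; l \<in> carrier L; a1 \<in> carrier A; a2 \<in> carrier A;
        k1 \<in> carrier K; k2 \<in> carrier K\<rbrakk> \<Longrightarrow>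
      \<nu> b (f l (a1 \<otimes>\<^bsub>A\<^esub> a2) \<otimes>\<^bsub>K\<^esub> \<alpha> l (\<mu> a2 k1 \<otimes>\<^bsub>K\<^esub> k2))
      = \<mu> (\<beta> b a2) (\<nu> b (f l a1 \<otimes>\<^bsub>K\<^esub> \<alpha> l k1)) \<otimes>\<^bsub>K\<^esub> \<nu> b (f l a2 \<otimes>\<^bsub>K\<^esub> \<alpha> l k2)"
    and cond_iii: "\<lbrakk>a1 \<in> carrier A; a2 \<in> carrier A; k1 \<in> carrier K; k2 \<in> carrier K\<rbrakk> \<Longrightarrow>
      \<sigma> (T a2) (S (inv_into (carrier K) (\<nu> (T a1)) k1))
        \<otimes>\<^bsub>L\<^esub> S (inv_into (carrier K) (\<nu> (T a2)) k2)
      = S (inv_into (carrier K) (\<nu> (T a1 \<otimes>\<^bsub>B\<^esub> T a2))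
          (\<mu> (\<beta> (T a1) a2) k1 \<otimes>\<^bsub>K\<^esub>
           \<nu> (T a1) (f (S (inv_into (carrier K) (\<nu> (T a1)) k1)) a2 \<otimes>\<^bsub>K\<^esub>
                    \<alpha> (S (inv_into (carrier K) (\<nu> (T a1)) k1)) k2)))"

text \<open>The twisting acts on the left factor of the fibre:
  \<open>(a1, k1) (a2, k2) = (a1 a2, \<mu>\<^sub>a\<^sub>2(k1) k2)\<close>, with \<open>\<mu>\<close> an anti-homomorphism.\<close>

definition semidirect_group ::
    "('a, 'm) monoid_scheme \<Rightarrow> ('k, 'n) monoid_scheme \<Rightarrow> ('a \<Rightarrow> 'k \<Rightarrow> 'k) \<Rightarrow> ('a \<times> 'k) monoid"
  where "semidirect_group A K \<mu> =
    \<lparr>carrier = carrier A \<times> carrier K,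
     mult = \<lambda>(a1, k1) (a2, k2). (a1 \<otimes>\<^bsub>A\<^esub> a2, \<mu> a2 k1 \<otimes>\<^bsub>K\<^esub> k2),
     one = (\<one>\<^bsub>A\<^esub>, \<one>\<^bsub>K\<^esub>)\<rparr>"

text \<open>The restriction to the carrier makes the values members of \<open>AutoGroup\<close>.\<close>

definition semidirect_action ::
    "('a, 'm) monoid_scheme \<Rightarrow> ('k, 'n) monoid_scheme \<Rightarrow> ('b \<Rightarrow> 'a \<Rightarrow> 'a) \<Rightarrow> ('l \<Rightarrow> 'k \<Rightarrow> 'k)
      \<Rightarrow> ('b \<Rightarrow> 'k \<Rightarrow> 'k) \<Rightarrow> ('l \<Rightarrow> 'a \<Rightarrow> 'k) \<Rightarrow> 'b \<times> 'l \<Rightarrow> 'a \<times> 'k \<Rightarrow> 'a \<times> 'k"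
  where "semidirect_action A K \<beta> \<alpha> \<nu> f = (\<lambda>(b, l).
    restrict (\<lambda>(a, k). (\<beta> b a, \<nu> b (f l a \<otimes>\<^bsub>K\<^esub> \<alpha> l k))) (carrier A \<times> carrier K))"

definition semidirect_operator ::
    "('k, 'n) monoid_scheme \<Rightarrow> ('a \<Rightarrow> 'b) \<Rightarrow> ('k \<Rightarrow> 'l) \<Rightarrow> ('b \<Rightarrow> 'k \<Rightarrow> 'k) \<Rightarrow> 'a \<times> 'k \<Rightarrow> 'b \<times> 'l"
  where "semidirect_operator K T S \<nu> = (\<lambda>(a, k). (T a, S (inv_into (carrier K) (\<nu> (T a)) k)))"

end

theory Submission
  imports Defs
begin

text \<open>Every element of the middle term of a split-extension is uniquely \<open>sH a \<cdot> i1 k\<close>, so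
  \<open>(a, k) \<mapsto> sH a \<cdot> i1 k\<close> is a bijection. Transporting the structure along it gives a semi-direct
  product: \<open>\<mu>\<close> and \<open>\<sigma>\<close> are conjugation by the sections, \<open>\<nu>\<^sub>b\<close> is the restriction of the action
  of \<open>sG b\<close> to \<open>K\<close>, and \<open>f l a\<close> is the \<open>K\<close>-part of the action of \<open>i2 l\<close> on \<open>sH a\<close>. In the other
  direction, conditions (i)-(iii) are the axioms of the semi-direct product read off in the second
  component, and they force \<open>f l 1 = 1 = f 1 a\<close>, which makes the inclusions and sections
  equivariant.\<close>

section \<open>Actions by automorphisms\<close>

text \<open>A homomorphism into \<open>AutoGroup K\<close>, unfolded pointwise. Bijectivity is not
  an axiom because \<open>\<theta> (inv x)\<close> inverts \<open>\<theta> x\<close>; extensionality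
  is one because automorphisms are compared as total functions.\<close>

locale automorphism_action = X: group X + K: group K
  for X :: "('x, 'mx) monoid_scheme" and K :: "('k, 'mk) monoid_scheme" +
  fixes \<theta> :: "'x \<Rightarrow> 'k \<Rightarrow> 'k"
  assumes extensional: "x \<in> carrier X \<Longrightarrow> \<theta> x \<in> extensional (carrier K)"
    and closed [simp, intro]: "\<lbrakk>x \<in> carrier X; k \<in> carrier K\<rbrakk> \<Longrightarrow> \<theta> x k \<in> carrier K"
    and mult: "\<lbrakk>x \<in> carrier X; k \<in> carrier K; l \<in> carrier K\<rbrakk>
      \<Longrightarrow> \<theta> x (k \<otimes>\<^bsub>K\<^esub> l) = \<theta> x k \<otimes>\<^bsub>K\<^esub> \<theta> x l"
    and one_action [simp]: "k \<in> carrier K \<Longrightarrow> \<theta> \<one>\<^bsub>X\<^esub> k = k"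
    and mult_action: "\<lbrakk>x \<in> carrier X; y \<in> carrier X; k \<in> carrier K\<rbrakk>
      \<Longrightarrow> \<theta> (x \<otimes>\<^bsub>X\<^esub> y) k = \<theta> x (\<theta> y k)"
begin

lemma one [simp]: "x \<in> carrier X \<Longrightarrow> \<theta> x \<one>\<^bsub>K\<^esub> = \<one>\<^bsub>K\<^esub>"
  by (metis K.l_cancel_one K.one_closed K.r_one closed mult)

lemma bij: "x \<in> carrier X \<Longrightarrow> bij_betw (\<theta> x) (carrier K) (carrier K)"
  by (rule bij_betw_byWitness [where f' = "\<theta> (inv\<^bsub>X\<^esub> x)"])
    (auto simp flip: mult_action)

lemma inv_into_closed [simp, intro]:
  "\<lbrakk>x \<in> carrier X; k \<in> carrier K\<rbrakk> \<Longrightarrow> inv_into (carrier K) (\<theta> x) k \<in> carrier K"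
  by (metis bij bij_betw_def inv_into_into)

lemma apply_inv_into [simp]:
  "\<lbrakk>x \<in> carrier X; k \<in> carrier K\<rbrakk> \<Longrightarrow> \<theta> x (inv_into (carrier K) (\<theta> x) k) = k"
  by (metis bij bij_betw_inv_into_right)

lemma inv_into_apply [simp]:
  "\<lbrakk>x \<in> carrier X; k \<in> carrier K\<rbrakk> \<Longrightarrow> inv_into (carrier K) (\<theta> x) (\<theta> x k) = k"
  by (metis bij bij_betw_inv_into_left)

lemma inv_into_one [simp]: "x \<in> carrier X \<Longrightarrow> inv_into (carrier K) (\<theta> x) \<one>\<^bsub>K\<^esub> = \<one>\<^bsub>K\<^esub>"
  using inv_into_apply [of x "\<one>\<^bsub>K\<^esub>"] by simp

lemma inv_into_one_action [simp]:
  "k \<in> carrier K \<Longrightarrow> inv_into (carrier K) (\<theta> \<one>\<^bsub>X\<^esub>) k = k"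
  using inv_into_apply [of "\<one>\<^bsub>X\<^esub>" k] by simp

lemma hom_AutoGroup: "\<theta> \<in> hom X (AutoGroup K)"
proof (rule homI)
  fix x assume x: "x \<in> carrier X"
  then show "\<theta> x \<in> carrier (AutoGroup K)"
    by (auto simp: AutoGroup_def auto_def Bij_def bij extensional mult intro: homI)
next
  fix x y assume xy: "x \<in> carrier X" "y \<in> carrier X"
  \<comment> \<open>The product in \<open>AutoGroup K\<close> is restricted composition; both sides
    are extensional, so agreement on the carrier is enough.\<close>
  then have "compose (carrier K) (\<theta> x) (\<theta> y) = \<theta> (x \<otimes>\<^bsub>X\<^esub> y)"
    by (intro extensionalityI [where A = "carrier K"])
      (auto simp: extensional compose_eq mult_action)
  with xy show "\<theta> (x \<otimes>\<^bsub>X\<^esub> y) = \<theta> x \<otimes>\<^bsub>AutoGroup K\<^esub> \<theta> y"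
    by (simp add: AutoGroup_def BijGroup_def Bij_def bij extensional)
qed

end

lemma automorphism_action_of_hom:
  assumes "group X" "group K" and \<theta>: "\<theta> \<in> hom X (AutoGroup K)"
  shows "automorphism_action X K \<theta>"
proof -
  interpret X: group X by fact
  interpret K: group K by fact
  interpret group_hom X "AutoGroup K" \<theta>
    using \<theta> by (simp add: group_hom_def group_hom_axioms_def K.AutoGroup X.group_axioms)
  have auto: "\<theta> x \<in> auto K" if "x \<in> carrier X" for x
    using hom_closed [OF that] by (simp add: AutoGroup_def)
  have Bij: "\<theta> x \<in> Bij (carrier K)" if "x \<in> carrier X" for x
    using auto [OF that] by (simp add: auto_def)
  show ?thesis
  proof
    fix x k l assume x: "x \<in> carrier X" and "k \<in> carrier K" "l \<in> carrier K"
    then show "\<theta> x (k \<otimes>\<^bsub>K\<^esub> l) = \<theta> x k \<otimes>\<^bsub>K\<^esub> \<theta> x l"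
      using auto [OF x] by (simp add: auto_def Group.hom_mult)
  next
    fix k assume "k \<in> carrier K"
    then show "\<theta> \<one>\<^bsub>X\<^esub> k = k"
      using hom_one by (simp add: AutoGroup_def BijGroup_def)
  next
    fix x y k assume "x \<in> carrier X" "y \<in> carrier X" "k \<in> carrier K"
    then show "\<theta> (x \<otimes>\<^bsub>X\<^esub> y) k = \<theta> x (\<theta> y k)"
      by (simp add: AutoGroup_def BijGroup_def Bij compose_eq)
  qed (use Bij in \<open>auto dest: Bij_imp_extensional Bij_imp_funcset\<close>)
qed

section \<open>Anti-homomorphisms as actions of the opposite group, and semi-direct products of
  groups\<close>

definition opposite :: "('a, 'm) monoid_scheme \<Rightarrow> ('a, 'm) monoid_scheme"
  where "opposite G = G\<lparr>mult := \<lambda>x y. y \<otimes>\<^bsub>G\<^esub> x\<rparr>"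

lemma opposite_simps [simp]:
  "carrier (opposite G) = carrier G" "\<one>\<^bsub>opposite G\<^esub> = \<one>\<^bsub>G\<^esub>"
  "x \<otimes>\<^bsub>opposite G\<^esub> y = y \<otimes>\<^bsub>G\<^esub> x"
  by (simp_all add: opposite_def)

lemma (in group) group_opposite: "group (opposite G)"
  by (rule groupI) (auto simp: m_assoc intro: r_inv)

lemma anti_hom_eq_hom_opposite: "anti_hom G H = hom (opposite G) H"
  by (auto simp: anti_hom_def hom_def)

text \<open>Associativity compares \<open>\<mu> c (\<mu> b k)\<close> with
  \<open>\<mu> (b c) k\<close>, which is why the action is one of the opposite group.\<close>

lemma (in group) semidirect_group_is_group:
  assumes "automorphism_action (opposite G) K \<mu>"
  shows "group (semidirect_group G K \<mu>)"
proof -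
  interpret \<mu>: automorphism_action "opposite G" K \<mu> by fact
  note \<mu> = \<mu>.mult_action [simplified] \<mu>.closed [simplified] \<mu>.one_action [simplified]
    \<mu>.mult [simplified] \<mu>.one [simplified]
  show ?thesis
  proof (rule groupI)
    fix x assume "x \<in> carrier (semidirect_group G K \<mu>)"
    then obtain a k where x: "x = (a, k)" "a \<in> carrier G" "k \<in> carrier K"
      by (auto simp: semidirect_group_def)
    \<comment> \<open>A left inverse suffices for \<open>groupI\<close>. Multiplying by
      \<open>x\<close> on the right applies \<open>\<mu> a\<close> to the second coordinate, which
      cancels \<open>\<mu> (inv a)\<close> and leaves the inverse of \<open>k\<close> times
      \<open>k\<close>.\<close>
    let ?y = "(inv a, \<mu> (inv a) (inv\<^bsub>K\<^esub> k))"
    have "?y \<otimes>\<^bsub>semidirect_group G K \<mu>\<^esub> x = \<one>\<^bsub>semidirect_group G K \<mu>\<^esub>"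
      using x by (simp add: semidirect_group_def \<mu> flip: \<mu>(1))
    moreover have "?y \<in> carrier (semidirect_group G K \<mu>)"
      using x by (simp add: semidirect_group_def \<mu>)
    ultimately show "\<exists>y\<in>carrier (semidirect_group G K \<mu>).
        y \<otimes>\<^bsub>semidirect_group G K \<mu>\<^esub> x = \<one>\<^bsub>semidirect_group G K \<mu>\<^esub>" by blast
  qed (auto simp: semidirect_group_def \<mu> m_assoc \<mu>.K.m_assoc)
qed

section \<open>Relative Rota-Baxter groups\<close>

context rel_rota_baxter_group
begin

sublocale action: automorphism_action G H \<phi>
  by (rule automorphism_action_of_hom [OF G.group_axioms H.group_axioms action_hom])

lemma R_in_carrier [simp, intro]: "h \<in> carrier H \<Longrightarrow> R h \<in> carrier G"
  using R_closed by auto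

text \<open>Automorphisms fix the identity, so the Rota-Baxter identity at two identities makes this
  value idempotent.\<close>

lemma R_one [simp]: "R \<one>\<^bsub>H\<^esub> = \<one>\<^bsub>G\<^esub>"
  using R_mult [of "\<one>\<^bsub>H\<^esub>" "\<one>\<^bsub>H\<^esub>"] by simp

end

text \<open>Needed because \<open>compose_parts\<close> runs from the semi-direct product to the
  given middle term, while the equivalence is wanted in the other direction.\<close>

lemma rel_rota_baxter_iso_inverse:
  assumes "rel_rota_baxter_iso H G \<phi> R H' G' \<phi>' R' \<psi> \<eta>"
  shows "rel_rota_baxter_iso H' G' \<phi>' R' H G \<phi> R
    (inv_into (carrier H) \<psi>) (inv_into (carrier G) \<eta>)"
proof -
  interpret rel_rota_baxter_iso H G \<phi> R H' G' \<phi>' R' \<psi> \<eta> by fact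
  let ?\<psi> = "inv_into (carrier H) \<psi>" and ?\<eta> = "inv_into (carrier G) \<eta>"
  have hom: "?\<psi> \<in> hom H' H" "?\<eta> \<in> hom G' G"
    using source.H.iso_set_sym [of \<psi> H'] source.G.iso_set_sym [of \<eta> G']
    by (auto simp: iso_def \<psi>_hom \<eta>_hom \<psi>_bij \<eta>_bij)
  note closed = hom_in_carrier [OF hom(1)] hom_in_carrier [OF hom(2)]
  note right = bij_betw_inv_into_right [OF \<psi>_bij] bij_betw_inv_into_right [OF \<eta>_bij]
  show ?thesis
  proof
    fix h assume h: "h \<in> carrier H'"
    have "\<eta> (R (?\<psi> h)) = R' h"
      using h by (simp add: R_commute closed right)
    then show "?\<eta> (R' h) = R (?\<psi> h)"
      using h bij_betw_inv_into_left [OF \<eta>_bij] by (metis closed(1) source.R_in_carrier)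
  next
    fix g h assume gh: "g \<in> carrier G'" "h \<in> carrier H'"
    have "\<psi> (\<phi> (?\<eta> g) (?\<psi> h)) = \<phi>' g h"
      using gh by (simp add: action_commute closed right)
    then show "?\<psi> (\<phi>' g h) = \<phi> (?\<eta> g) (?\<psi> h)"
      using gh bij_betw_inv_into_left [OF \<psi>_bij] by (metis closed source.action.closed)
  qed (auto simp: hom \<psi>_bij \<eta>_bij intro: bij_betw_inv_into)
qed

section \<open>From semi-direct data to a split-extension\<close>

context rel_rota_baxter_semidirect_data
begin

sublocale \<nu>: automorphism_action B K \<nu>
  by (rule automorphism_action_of_hom [OF base.G.group_axioms fibre.H.group_axioms \<nu>_hom])

sublocale \<mu>: automorphism_action "opposite A" K \<mu>
  using automorphism_action_of_hom [OF base.H.group_opposite fibre.H.group_axioms] \<mu>_anti_hom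
  by (simp add: anti_hom_eq_hom_opposite)

sublocale \<sigma>: automorphism_action "opposite B" L \<sigma>
  using automorphism_action_of_hom [OF base.G.group_opposite fibre.G.group_axioms] \<sigma>_anti_hom
  by (simp add: anti_hom_eq_hom_opposite)

lemma f_in_carrier [simp, intro]: "\<lbrakk>l \<in> carrier L; a \<in> carrier A\<rbrakk> \<Longrightarrow> f l a \<in> carrier K"
  using f_closed by auto

lemmas \<mu>_simps [simp] = \<mu>.closed [simplified] \<mu>.one [simplified] \<mu>.one_action [simplified]
lemmas \<sigma>_simps [simp] = \<sigma>.closed [simplified] \<sigma>.one [simplified] \<sigma>.one_action [simplified]

text \<open>With identities in all other places, (ii) says that this element of \<open>K\<close> is
  idempotent; (i) does the same for \<open>f_one_left\<close>.\<close>

lemma f_one_right [simp]: "l \<in> carrier L \<Longrightarrow> f l \<one>\<^bsub>A\<^esub> = \<one>\<^bsub>K\<^esub>"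
  using cond_ii [of "\<one>\<^bsub>B\<^esub>" l "\<one>\<^bsub>A\<^esub>" "\<one>\<^bsub>A\<^esub>" "\<one>\<^bsub>K\<^esub>" "\<one>\<^bsub>K\<^esub>"] by simp

lemma f_one_left [simp]: "a \<in> carrier A \<Longrightarrow> f \<one>\<^bsub>L\<^esub> a = \<one>\<^bsub>K\<^esub>"
  using cond_i [of "\<one>\<^bsub>B\<^esub>" "\<one>\<^bsub>L\<^esub>" "\<one>\<^bsub>L\<^esub>" a "\<one>\<^bsub>K\<^esub>"] by simp

text \<open>The first components are the laws of \<open>(A, B, \<beta>, T)\<close>. In the second,
  (i) under an outer \<open>\<nu>\<close> is the composition law of the action, (ii) its
  multiplicativity, and (iii) the Rota-Baxter identity.\<close>

lemma rel_rota_baxter_group_semidirect: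
  "rel_rota_baxter_group (semidirect_group A K \<mu>) (semidirect_group B L \<sigma>)
    (semidirect_action A K \<beta> \<alpha> \<nu> f) (semidirect_operator K T S \<nu>)"
proof -
  interpret H: group "semidirect_group A K \<mu>"
    by (rule base.H.semidirect_group_is_group) (rule \<mu>.automorphism_action_axioms)
  interpret G: group "semidirect_group B L \<sigma>"
    by (rule base.G.semidirect_group_is_group) (rule \<sigma>.automorphism_action_axioms)
  interpret automorphism_action "semidirect_group B L \<sigma>" "semidirect_group A K \<mu>"
      "semidirect_action A K \<beta> \<alpha> \<nu> f"
    using cond_ii cond_i
    by unfold_locales
      (auto simp: semidirect_group_def semidirect_action_def base.action.mult
        base.action.mult_action \<nu>.mult_action)
  show ?thesis
  proof
    show "semidirect_action A K \<beta> \<alpha> \<nu> f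
        \<in> hom (semidirect_group B L \<sigma>) (AutoGroup (semidirect_group A K \<mu>))"
      by (rule hom_AutoGroup)
  qed (use cond_iii in \<open>auto simp: semidirect_group_def semidirect_action_def
      semidirect_operator_def base.R_mult\<close>)
qed

text \<open>Over the identity of the base \<open>\<nu>\<close> is trivial and \<open>f l\<close>
  vanishes, so action and operator restrict to \<open>\<alpha>\<close> and \<open>S\<close> on the
  fibre.\<close>

lemma rel_rota_baxter_extension_semidirect:
  "rel_rota_baxter_extension A B \<beta> T K L \<alpha> S
    (semidirect_group A K \<mu>) (semidirect_group B L \<sigma>)
    (semidirect_action A K \<beta> \<alpha> \<nu> f) (semidirect_operator K T S \<nu>)
    (\<lambda>k. (\<one>\<^bsub>A\<^esub>, k)) (\<lambda>l. (\<one>\<^bsub>B\<^esub>, l)) (\<lambda>(a, k). a) (\<lambda>(b, l). b)"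
proof -
  interpret E: rel_rota_baxter_group "semidirect_group A K \<mu>" "semidirect_group B L \<sigma>"
      "semidirect_action A K \<beta> \<alpha> \<nu> f" "semidirect_operator K T S \<nu>"
    by (rule rel_rota_baxter_group_semidirect)
  show ?thesis
    by unfold_locales
      (force simp: semidirect_group_def semidirect_action_def semidirect_operator_def
        kernel_def inj_on_def intro!: homI)+
qed

lemma rel_rota_baxter_split_extension_semidirect:
  "rel_rota_baxter_split_extension A B \<beta> T K L \<alpha> S
    (semidirect_group A K \<mu>) (semidirect_group B L \<sigma>)
    (semidirect_action A K \<beta> \<alpha> \<nu> f) (semidirect_operator K T S \<nu>)
    (\<lambda>k. (\<one>\<^bsub>A\<^esub>, k)) (\<lambda>l. (\<one>\<^bsub>B\<^esub>, l)) (\<lambda>(a, k). a) (\<lambda>(b, l). b)"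
proof -
  interpret E: rel_rota_baxter_extension A B \<beta> T K L \<alpha> S
    "semidirect_group A K \<mu>" "semidirect_group B L \<sigma>"
    "semidirect_action A K \<beta> \<alpha> \<nu> f" "semidirect_operator K T S \<nu>"
    "\<lambda>k. (\<one>\<^bsub>A\<^esub>, k)" "\<lambda>l. (\<one>\<^bsub>B\<^esub>, l)" "\<lambda>(a, k). a" "\<lambda>(b, l). b"
    by (rule rel_rota_baxter_extension_semidirect)
  \<comment> \<open>The sections put the identity in the fibre coordinate. It is preserved by the
    twists, by the action because \<open>f\<close> vanishes at the identity of \<open>L\<close>, and
    by the operator because \<open>S\<close> fixes identities.\<close>
  have "rel_rota_baxter_hom A B \<beta> T (semidirect_group A K \<mu>) (semidirect_group B L \<sigma>)
      (semidirect_action A K \<beta> \<alpha> \<nu> f) (semidirect_operator K T S \<nu>)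
      (\<lambda>a. (a, \<one>\<^bsub>K\<^esub>)) (\<lambda>b. (b, \<one>\<^bsub>L\<^esub>))"
    by unfold_locales
      (auto simp: semidirect_group_def semidirect_action_def semidirect_operator_def intro!: homI)
  then show ?thesis
    by unfold_locales fastforce
qed

end

section \<open>Split extensions of groups\<close>

locale split_group_extension = i: group_hom K H i + p: group_hom H A p + s: group_hom A H s
  for A :: "('a, 'ma) monoid_scheme" and K :: "('k, 'mk) monoid_scheme"
    and H :: "('h, 'mh) monoid_scheme" and i p s +
  assumes inj: "inj_on i (carrier K)"
    and exact: "i ` carrier K = kernel H A p"
    and section_eq [simp]: "a \<in> carrier A \<Longrightarrow> p (s a) = a"
begin

lemma p_i [simp]: "k \<in> carrier K \<Longrightarrow> p (i k) = \<one>\<^bsub>A\<^esub>"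
  using exact by (auto simp: kernel_def)

lemma i_eq_iff [simp]: "\<lbrakk>k \<in> carrier K; l \<in> carrier K\<rbrakk> \<Longrightarrow> i k = i l \<longleftrightarrow> k = l"
  using inj by (auto simp: inj_on_def)

text \<open>Since \<open>s\<close> is a section of \<open>p\<close>, the argument of
  \<open>inv_into\<close> lies in the kernel of \<open>p\<close>, hence in the image of
  \<open>i\<close>; injectivity of \<open>i\<close> makes the preimage unique.\<close>

definition fibre_part :: "'h \<Rightarrow> 'k"
  where "fibre_part h = inv_into (carrier K) i (inv\<^bsub>H\<^esub> s (p h) \<otimes>\<^bsub>H\<^esub> h)"

lemma fibre_part_aux: "h \<in> carrier H \<Longrightarrow> inv\<^bsub>H\<^esub> s (p h) \<otimes>\<^bsub>H\<^esub> h \<in> i ` carrier K"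
  unfolding exact by (simp add: kernel_def)

lemma fibre_part_closed [simp, intro]: "h \<in> carrier H \<Longrightarrow> fibre_part h \<in> carrier K"
  using fibre_part_aux by (auto simp: fibre_part_def intro: inv_into_into)

lemma decompose [simp]: "h \<in> carrier H \<Longrightarrow> s (p h) \<otimes>\<^bsub>H\<^esub> i (fibre_part h) = h"
  using fibre_part_aux by (simp add: fibre_part_def f_inv_into_f flip: i.H.m_assoc)

definition compose_parts :: "'a \<times> 'k \<Rightarrow> 'h"
  where "compose_parts = (\<lambda>(a, k). s a \<otimes>\<^bsub>H\<^esub> i k)"

text \<open>Conjugation by the inverse of \<open>s a\<close>, pulled back along \<open>i\<close>:
  the product \<open>i k\<close> times \<open>s a\<close> lies over \<open>a\<close>, so
  \<open>fibre_part\<close> strips \<open>s a\<close> from its left. The restriction makes the map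
  extensional.\<close>

definition twist :: "'a \<Rightarrow> 'k \<Rightarrow> 'k"
  where "twist a = (\<lambda>k \<in> carrier K. fibre_part (i k \<otimes>\<^bsub>H\<^esub> s a))"

lemma twist_closed [simp, intro]:
  "\<lbrakk>a \<in> carrier A; k \<in> carrier K\<rbrakk> \<Longrightarrow> twist a k \<in> carrier K"
  by (simp add: twist_def)

lemma section_twist: "\<lbrakk>a \<in> carrier A; k \<in> carrier K\<rbrakk>
    \<Longrightarrow> s a \<otimes>\<^bsub>H\<^esub> i (twist a k) = i k \<otimes>\<^bsub>H\<^esub> s a"
  using decompose [of "i k \<otimes>\<^bsub>H\<^esub> s a"] by (simp add: twist_def)

lemma i_twist: "\<lbrakk>a \<in> carrier A; k \<in> carrier K\<rbrakk>
    \<Longrightarrow> i (twist a k) = inv\<^bsub>H\<^esub> s a \<otimes>\<^bsub>H\<^esub> (i k \<otimes>\<^bsub>H\<^esub> s a)"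
  by (simp add: i.H.inv_solve_left section_twist)

lemma bij_compose_parts: "bij_betw compose_parts (carrier A \<times> carrier K) (carrier H)"
proof (rule bij_betwI')
  show "compose_parts x = compose_parts y \<longleftrightarrow> x = y"
    if "x \<in> carrier A \<times> carrier K" "y \<in> carrier A \<times> carrier K" for x y
  proof
    \<comment> \<open>Applying \<open>p\<close> kills the fibre factor, so the base coordinates
      agree; cancelling the common section value leaves an equation under the injective
      \<open>i\<close>.\<close>
    assume eq: "compose_parts x = compose_parts y"
    then have "p (compose_parts x) = p (compose_parts y)" by simp
    with that have "fst x = fst y" by (auto simp: compose_parts_def)
    with eq that show "x = y" by (auto simp: compose_parts_def)
  qed simp
  show "\<exists>x\<in>carrier A \<times> carrier K. h = compose_parts x" if "h \<in> carrier H" for h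
    using that by (intro bexI [of _ "(p h, fibre_part h)"]) (auto simp: compose_parts_def)
qed (auto simp: compose_parts_def)

text \<open>Under the injective \<open>i\<close> these are the laws of conjugation. Conjugating by
  \<open>s a\<close> first and by \<open>s b\<close> second is conjugation by their product in this
  order, hence an action of the opposite group.\<close>

lemma automorphism_action_twist: "automorphism_action (opposite A) K twist"
proof -
  interpret opposite: group "opposite A" by (rule p.H.group_opposite)
  have cancel: "x \<otimes>\<^bsub>H\<^esub> (inv\<^bsub>H\<^esub> x \<otimes>\<^bsub>H\<^esub> y) = y" if "x \<in> carrier H" "y \<in> carrier H" for x y
    using that by (simp flip: i.H.m_assoc)
  have "twist a (k \<otimes>\<^bsub>K\<^esub> l) = twist a k \<otimes>\<^bsub>K\<^esub> twist a l"
    if "a \<in> carrier A" "k \<in> carrier K" "l \<in> carrier K" for a k l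
    using that by (simp add: i_twist i.H.m_assoc cancel flip: i_eq_iff)
  moreover have "twist \<one>\<^bsub>A\<^esub> k = k" if "k \<in> carrier K" for k
    using that by (simp add: i_twist flip: i_eq_iff)
  moreover have "twist (a \<otimes>\<^bsub>A\<^esub> b) k = twist b (twist a k)"
    if "a \<in> carrier A" "b \<in> carrier A" "k \<in> carrier K" for a b k
    using that by (simp add: i_twist i.H.m_assoc i.H.inv_mult_group flip: i_eq_iff)
  ultimately show ?thesis
    by unfold_locales (simp_all, simp add: twist_def)
qed

text \<open>The twist is exactly the correction incurred by moving \<open>i k\<close> to the right
  past \<open>s b\<close>.\<close>

lemma compose_parts_hom: "compose_parts \<in> hom (semidirect_group A K twist) H"
proof (rule homI)
  fix x y assume "x \<in> carrier (semidirect_group A K twist)" "y \<in> carrier (semidirect_group A K twist)"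
  then obtain a k b l where xy: "x = (a, k)" "y = (b, l)"
    and in_carrier: "a \<in> carrier A" "k \<in> carrier K" "b \<in> carrier A" "l \<in> carrier K"
    by (auto simp: semidirect_group_def)
  have "s a \<otimes>\<^bsub>H\<^esub> s b \<otimes>\<^bsub>H\<^esub> (i (twist b k) \<otimes>\<^bsub>H\<^esub> i l)
      = s a \<otimes>\<^bsub>H\<^esub> (s b \<otimes>\<^bsub>H\<^esub> i (twist b k)) \<otimes>\<^bsub>H\<^esub> i l"
    using in_carrier by (simp add: i.H.m_assoc)
  also have "\<dots> = s a \<otimes>\<^bsub>H\<^esub> i k \<otimes>\<^bsub>H\<^esub> (s b \<otimes>\<^bsub>H\<^esub> i l)"
    using in_carrier by (simp add: section_twist i.H.m_assoc)
  finally show "compose_parts (x \<otimes>\<^bsub>semidirect_group A K twist\<^esub> y)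
      = compose_parts x \<otimes>\<^bsub>H\<^esub> compose_parts y"
    using in_carrier by (simp add: xy semidirect_group_def compose_parts_def)
qed (auto simp: semidirect_group_def compose_parts_def)

end

section \<open>Split extensions of relative Rota-Baxter groups\<close>

text \<open>Fixes one pair of sections, whose mere existence defines a split-extension, so that the
  semi-direct data can be defined from it.\<close>

locale rel_rota_baxter_extension_section =
  rel_rota_baxter_extension A B \<beta> T K L \<alpha> S H G \<phi> R i1 i2 p1 p2 +
  splitting: rel_rota_baxter_hom A B \<beta> T H G \<phi> R sH sG
  for A :: "('a, 'ma) monoid_scheme" and B :: "('b, 'mb) monoid_scheme" and \<beta> T
    and K :: "('k, 'mk) monoid_scheme" and L :: "('l, 'ml) monoid_scheme" and \<alpha> S
    and H :: "('h, 'mh) monoid_scheme" and G :: "('g, 'mg) monoid_scheme" and \<phi> R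
    and i1 i2 p1 p2 sH sG +
  assumes p1_sH: "a \<in> carrier A \<Longrightarrow> p1 (sH a) = a"
    and p2_sG: "b \<in> carrier B \<Longrightarrow> p2 (sG b) = b"
begin

sublocale H: split_group_extension A K H i1 p1 sH
  by unfold_locales
    (auto simp: embedding.\<psi>_hom projection.\<psi>_hom splitting.\<psi>_hom embedding.\<psi>_inj exact1 p1_sH)

sublocale G: split_group_extension B L G i2 p2 sG
  by unfold_locales
    (auto simp: embedding.\<eta>_hom projection.\<eta>_hom splitting.\<eta>_hom embedding.\<eta>_inj exact2 p2_sG)

section \<open>The data determined by a pair of sections\<close>

definition \<nu> :: "'b \<Rightarrow> 'k \<Rightarrow> 'k"
  where "\<nu> b = (\<lambda>k \<in> carrier K. H.fibre_part (\<phi> (sG b) (i1 k)))"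

definition f :: "'l \<Rightarrow> 'a \<Rightarrow> 'k"
  where "f l a = H.fibre_part (\<phi> (i2 l) (sH a))"

lemma \<nu>_closed [simp, intro]: "\<lbrakk>b \<in> carrier B; k \<in> carrier K\<rbrakk> \<Longrightarrow> \<nu> b k \<in> carrier K"
  by (simp add: \<nu>_def)

lemma f_closed [simp, intro]: "\<lbrakk>l \<in> carrier L; a \<in> carrier A\<rbrakk> \<Longrightarrow> f l a \<in> carrier K"
  by (simp add: f_def)

text \<open>By equivariance of the projection, the right-hand side lies over the identity, so its
  base factor is trivial.\<close>

lemma i1_\<nu>: "\<lbrakk>b \<in> carrier B; k \<in> carrier K\<rbrakk> \<Longrightarrow> i1 (\<nu> b k) = \<phi> (sG b) (i1 k)"
  using H.decompose [of "\<phi> (sG b) (i1 k)"]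
  by (simp add: \<nu>_def projection.action_commute)

text \<open>The element \<open>i2 l\<close> lies over the identity of \<open>B\<close> and so acts
  trivially on \<open>A\<close>; hence the base factor is still \<open>sH a\<close>.\<close>

lemma sH_f: "\<lbrakk>l \<in> carrier L; a \<in> carrier A\<rbrakk> \<Longrightarrow> sH a \<otimes>\<^bsub>H\<^esub> i1 (f l a) = \<phi> (i2 l) (sH a)"
  using H.decompose [of "\<phi> (i2 l) (sH a)"]
  by (simp add: f_def projection.action_commute)

lemma automorphism_action_\<nu>: "automorphism_action B K \<nu>"
proof -
  have "\<nu> b (k \<otimes>\<^bsub>K\<^esub> l) = \<nu> b k \<otimes>\<^bsub>K\<^esub> \<nu> b l"
    if "b \<in> carrier B" "k \<in> carrier K" "l \<in> carrier K" for b k l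
    using that by (simp add: i1_\<nu> embedding.target.action.mult flip: H.i_eq_iff)
  moreover have "\<nu> \<one>\<^bsub>B\<^esub> k = k" if "k \<in> carrier K" for k
    using that by (simp add: i1_\<nu> flip: H.i_eq_iff)
  moreover have "\<nu> (b \<otimes>\<^bsub>B\<^esub> c) k = \<nu> b (\<nu> c k)"
    if "b \<in> carrier B" "c \<in> carrier B" "k \<in> carrier K" for b c k
    using that by (simp add: i1_\<nu> embedding.target.action.mult_action flip: H.i_eq_iff)
  ultimately show ?thesis
    by unfold_locales (simp_all, simp add: \<nu>_def)
qed

sublocale \<nu>: automorphism_action B K \<nu>
  by (rule automorphism_action_\<nu>)

text \<open>First \<open>i2 l\<close> acts, through \<open>f\<close> on \<open>sH a\<close> and
  through \<open>\<alpha>\<close> on the fibre; then \<open>sG b\<close> acts, through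
  \<open>\<beta>\<close> on the section and through \<open>\<nu>\<close> on the fibre.\<close>

lemma compose_parts_action:
  assumes "x \<in> carrier B \<times> carrier L" "y \<in> carrier A \<times> carrier K"
  shows "H.compose_parts (semidirect_action A K \<beta> \<alpha> \<nu> f x y)
    = \<phi> (G.compose_parts x) (H.compose_parts y)"
proof -
  obtain b l a k where xy: "x = (b, l)" "y = (a, k)"
    and in_carrier: "b \<in> carrier B" "l \<in> carrier L" "a \<in> carrier A" "k \<in> carrier K"
    using assms by auto
  have "\<phi> (sG b \<otimes>\<^bsub>G\<^esub> i2 l) (sH a \<otimes>\<^bsub>H\<^esub> i1 k)
      = \<phi> (sG b) (\<phi> (i2 l) (sH a) \<otimes>\<^bsub>H\<^esub> \<phi> (i2 l) (i1 k))"
    using in_carrier by (simp add: embedding.target.action.mult_action embedding.target.action.mult)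
  also have "\<dots> = \<phi> (sG b) (sH a \<otimes>\<^bsub>H\<^esub> i1 (f l a \<otimes>\<^bsub>K\<^esub> \<alpha> l k))"
    using in_carrier by (simp add: embedding.action_commute embedding.target.H.m_assoc flip: sH_f)
  also have "\<dots> = sH (\<beta> b a) \<otimes>\<^bsub>H\<^esub> i1 (\<nu> b (f l a \<otimes>\<^bsub>K\<^esub> \<alpha> l k))"
    using in_carrier by (simp add: i1_\<nu> splitting.action_commute embedding.target.action.mult)
  finally show ?thesis
    using in_carrier
    by (simp add: xy semidirect_action_def H.compose_parts_def G.compose_parts_def)
qed

text \<open>Put \<open>k' = \<nu>\<^sub>T\<^sub>a\<^sup>-\<^sup>1(k)\<close>. Since \<open>R\<close> maps \<open>sH a\<close> to \<open>sG (T a)\<close>, the element \<open>sH a \<cdot> i1 k\<close> is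
  \<open>h \<cdot> \<phi>\<^bsub>R h\<^esub>(i1 k')\<close> for \<open>h = sH a\<close>, on which \<open>R\<close> is multiplicative.\<close>

lemma compose_parts_operator:
  assumes "x \<in> carrier A \<times> carrier K"
  shows "G.compose_parts (semidirect_operator K T S \<nu> x) = R (H.compose_parts x)"
proof -
  obtain a k where x: "x = (a, k)" and in_carrier: "a \<in> carrier A" "k \<in> carrier K"
    using assms by auto
  let ?k = "inv_into (carrier K) (\<nu> (T a)) k"
  have k: "?k \<in> carrier K"
    using in_carrier by simp
  have "sG (T a) \<otimes>\<^bsub>G\<^esub> i2 (S ?k) = R (sH a) \<otimes>\<^bsub>G\<^esub> R (i1 ?k)"
    using in_carrier k by (simp add: splitting.R_commute embedding.R_commute)
  also have "\<dots> = R (sH a \<otimes>\<^bsub>H\<^esub> \<phi> (sG (T a)) (i1 ?k))"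
    using in_carrier k by (simp add: embedding.target.R_mult splitting.R_commute)
  also have "\<dots> = R (sH a \<otimes>\<^bsub>H\<^esub> i1 k)"
    using in_carrier k by (simp flip: i1_\<nu>)
  finally show ?thesis
    by (simp add: x semidirect_operator_def H.compose_parts_def G.compose_parts_def)
qed

text \<open>The compatibility conditions say that the semi-direct action respects both products and the
  semi-direct operator is a Rota-Baxter operator. Hence they can be pulled back along the bijections
  \<open>compose_parts\<close>.\<close>

lemma semidirect_data:
  "rel_rota_baxter_semidirect_data A B \<beta> T K L \<alpha> S \<nu> H.twist G.twist f"
proof -
  let ?H = "semidirect_group A K H.twist" and ?G = "semidirect_group B L G.twist"
  let ?\<phi> = "semidirect_action A K \<beta> \<alpha> \<nu> f" and ?R = "semidirect_operator K T S \<nu>"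
  interpret \<mu>: automorphism_action "opposite A" K H.twist by (rule H.automorphism_action_twist)
  interpret \<sigma>: automorphism_action "opposite B" L G.twist by (rule G.automorphism_action_twist)
  interpret H': group ?H
    by (rule projection.target.H.semidirect_group_is_group) (rule \<mu>.automorphism_action_axioms)
  interpret G': group ?G
    by (rule projection.target.G.semidirect_group_is_group) (rule \<sigma>.automorphism_action_axioms)
  have carriers: "carrier ?H = carrier A \<times> carrier K" "carrier ?G = carrier B \<times> carrier L"
    by (simp_all add: semidirect_group_def)
  note inj = bij_betw_imp_inj_on [OF H.bij_compose_parts, THEN inj_onD]
    bij_betw_imp_inj_on [OF G.bij_compose_parts, THEN inj_onD]
  note homs = Group.hom_mult [OF H.compose_parts_hom] Group.hom_mult [OF G.compose_parts_hom]
  note parts_closed = hom_in_carrier [OF H.compose_parts_hom] hom_in_carrier [OF G.compose_parts_hom]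
  have act_closed: "?\<phi> x y \<in> carrier ?H" if "x \<in> carrier ?G" "y \<in> carrier ?H" for x y
    using that by (auto simp: carriers semidirect_action_def)
  have op_closed: "?R y \<in> carrier ?G" if "y \<in> carrier ?H" for y
    using that by (auto simp: carriers semidirect_operator_def)
  have action_comp: "?\<phi> (x \<otimes>\<^bsub>?G\<^esub> y) z = ?\<phi> x (?\<phi> y z)"
    if "x \<in> carrier ?G" "y \<in> carrier ?G" "z \<in> carrier ?H" for x y z
    using that
    by (intro inj(1))
      (simp_all add: compose_parts_action act_closed homs parts_closed
        embedding.target.action.mult_action flip: carriers)
  have action_mult: "?\<phi> x (y \<otimes>\<^bsub>?H\<^esub> z) = ?\<phi> x y \<otimes>\<^bsub>?H\<^esub> ?\<phi> x z"
    if "x \<in> carrier ?G" "y \<in> carrier ?H" "z \<in> carrier ?H" for x y z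
    using that
    by (intro inj(1))
      (simp_all add: compose_parts_action act_closed homs parts_closed
        embedding.target.action.mult flip: carriers)
  have operator_mult: "?R y \<otimes>\<^bsub>?G\<^esub> ?R z = ?R (y \<otimes>\<^bsub>?H\<^esub> ?\<phi> (?R y) z)"
    if "y \<in> carrier ?H" "z \<in> carrier ?H" for y z
    using that
    by (intro inj(2))
      (simp_all add: compose_parts_action compose_parts_operator act_closed op_closed homs
        parts_closed embedding.target.R_mult flip: carriers)
  show ?thesis
  proof
    show "\<nu> \<in> hom B (AutoGroup K)"
      by (rule \<nu>.hom_AutoGroup)
    show "H.twist \<in> anti_hom A (AutoGroup K)" "G.twist \<in> anti_hom B (AutoGroup L)"
      using \<mu>.hom_AutoGroup \<sigma>.hom_AutoGroup by (simp_all add: anti_hom_eq_hom_opposite)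
    show "f \<in> carrier L \<rightarrow> carrier A \<rightarrow> carrier K"
      by auto
  next
    fix b l1 l2 a1 k1
    assume "b \<in> carrier B" "l1 \<in> carrier L" "l2 \<in> carrier L" "a1 \<in> carrier A" "k1 \<in> carrier K"
    then show "\<nu> b (f (G.twist b l1 \<otimes>\<^bsub>L\<^esub> l2) a1 \<otimes>\<^bsub>K\<^esub> \<alpha> (G.twist b l1 \<otimes>\<^bsub>L\<^esub> l2) k1)
        = f l1 (\<beta> b a1) \<otimes>\<^bsub>K\<^esub> \<alpha> l1 (\<nu> b (f l2 a1 \<otimes>\<^bsub>K\<^esub> \<alpha> l2 k1))"
      \<comment> \<open>The identity in the first factor turns the outer \<open>\<nu>\<close> into
        the identity map, so the second components are precisely (i).\<close>
      using action_comp [of "(\<one>\<^bsub>B\<^esub>, l1)" "(b, l2)" "(a1, k1)"]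
      by (simp add: semidirect_group_def semidirect_action_def)
  next
    fix b l a1 a2 k1 k2
    assume "b \<in> carrier B" "l \<in> carrier L" "a1 \<in> carrier A" "a2 \<in> carrier A"
      "k1 \<in> carrier K" "k2 \<in> carrier K"
    then show "\<nu> b (f l (a1 \<otimes>\<^bsub>A\<^esub> a2) \<otimes>\<^bsub>K\<^esub> \<alpha> l (H.twist a2 k1 \<otimes>\<^bsub>K\<^esub> k2))
        = H.twist (\<beta> b a2) (\<nu> b (f l a1 \<otimes>\<^bsub>K\<^esub> \<alpha> l k1)) \<otimes>\<^bsub>K\<^esub> \<nu> b (f l a2 \<otimes>\<^bsub>K\<^esub> \<alpha> l k2)"
      using action_mult [of "(b, l)" "(a1, k1)" "(a2, k2)"]
      by (simp add: semidirect_group_def semidirect_action_def)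
  next
    fix a1 a2 k1 k2
    assume "a1 \<in> carrier A" "a2 \<in> carrier A" "k1 \<in> carrier K" "k2 \<in> carrier K"
    then show "G.twist (T a2) (S (inv_into (carrier K) (\<nu> (T a1)) k1))
          \<otimes>\<^bsub>L\<^esub> S (inv_into (carrier K) (\<nu> (T a2)) k2)
        = S (inv_into (carrier K) (\<nu> (T a1 \<otimes>\<^bsub>B\<^esub> T a2))
            (H.twist (\<beta> (T a1) a2) k1 \<otimes>\<^bsub>K\<^esub>
             \<nu> (T a1) (f (S (inv_into (carrier K) (\<nu> (T a1)) k1)) a2 \<otimes>\<^bsub>K\<^esub>
                      \<alpha> (S (inv_into (carrier K) (\<nu> (T a1)) k1)) k2)))"
      \<comment> \<open>The Rota-Baxter identity for \<open>T\<close> matches the index of the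
        inverted \<open>\<nu>\<close> in (iii) with the value of \<open>T\<close> at the first
        component of the product.\<close>
      using operator_mult [of "(a1, k1)" "(a2, k2)"]
      by (simp add: semidirect_group_def semidirect_action_def semidirect_operator_def
          projection.target.R_mult)
  qed
qed

lemma equivalent_semidirect:
  "rel_rota_baxter_equivalent_extensions A B \<beta> T K L \<alpha> S
    H G \<phi> R i1 i2 p1 p2
    (semidirect_group A K H.twist) (semidirect_group B L G.twist)
    (semidirect_action A K \<beta> \<alpha> \<nu> f) (semidirect_operator K T S \<nu>)
    (\<lambda>k. (\<one>\<^bsub>A\<^esub>, k)) (\<lambda>l. (\<one>\<^bsub>B\<^esub>, l)) (\<lambda>(a, k). a) (\<lambda>(b, l). b)"
proof -
  let ?H = "semidirect_group A K H.twist" and ?G = "semidirect_group B L G.twist"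
  let ?\<phi> = "semidirect_action A K \<beta> \<alpha> \<nu> f" and ?R = "semidirect_operator K T S \<nu>"
  interpret D: rel_rota_baxter_semidirect_data A B \<beta> T K L \<alpha> S \<nu> H.twist G.twist f
    by (rule semidirect_data)
  interpret E: rel_rota_baxter_extension A B \<beta> T K L \<alpha> S ?H ?G ?\<phi> ?R
    "\<lambda>k. (\<one>\<^bsub>A\<^esub>, k)" "\<lambda>l. (\<one>\<^bsub>B\<^esub>, l)" "\<lambda>(a, k). a" "\<lambda>(b, l). b"
    by (rule D.rel_rota_baxter_extension_semidirect)
  have carriers: "carrier ?H = carrier A \<times> carrier K" "carrier ?G = carrier B \<times> carrier L"
    by (simp_all add: semidirect_group_def)
  \<comment> \<open>The equivalence sends an element to its base and fibre parts. This explicit form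
    gives compatibility with the projections; compatibility with the inclusions holds because the
    sections fix identities.\<close>
  let ?\<eta> = "inv_into (carrier ?H) H.compose_parts" and ?\<zeta> = "inv_into (carrier ?G) G.compose_parts"
  have "rel_rota_baxter_iso ?H ?G ?\<phi> ?R H G \<phi> R H.compose_parts G.compose_parts"
    by unfold_locales
      (simp_all add: H.compose_parts_hom G.compose_parts_hom H.bij_compose_parts
        G.bij_compose_parts carriers compose_parts_action compose_parts_operator)
  then have "rel_rota_baxter_iso H G \<phi> R ?H ?G ?\<phi> ?R ?\<eta> ?\<zeta>"
    by (rule rel_rota_baxter_iso_inverse)
  moreover have \<eta>: "?\<eta> h = (p1 h, H.fibre_part h)" if "h \<in> carrier H" for h
    using that bij_betw_inv_into_left [OF H.bij_compose_parts, of "(p1 h, H.fibre_part h)"]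
    by (simp add: carriers H.compose_parts_def)
  moreover have \<zeta>: "?\<zeta> g = (p2 g, G.fibre_part g)" if "g \<in> carrier G" for g
    using that bij_betw_inv_into_left [OF G.bij_compose_parts, of "(p2 g, G.fibre_part g)"]
    by (simp add: carriers G.compose_parts_def)
  moreover have "?\<eta> (i1 k) = (\<one>\<^bsub>A\<^esub>, k)" if "k \<in> carrier K" for k
    using that bij_betw_inv_into_left [OF H.bij_compose_parts, of "(\<one>\<^bsub>A\<^esub>, k)"]
    by (simp add: carriers H.compose_parts_def)
  moreover have "?\<zeta> (i2 l) = (\<one>\<^bsub>B\<^esub>, l)" if "l \<in> carrier L" for l
    using that bij_betw_inv_into_left [OF G.bij_compose_parts, of "(\<one>\<^bsub>B\<^esub>, l)"]
    by (simp add: carriers G.compose_parts_def)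
  ultimately show ?thesis
    by unfold_locales (intro exI [of _ ?\<eta>] exI [of _ ?\<zeta>], simp)
qed

end

theorem theorem5p4:
  fixes A :: "('a, 'ma) monoid_scheme" and B :: "('b, 'mb) monoid_scheme"
    and \<beta> :: "'b \<Rightarrow> 'a \<Rightarrow> 'a" and T :: "'a \<Rightarrow> 'b"
    and K :: "('k, 'mk) monoid_scheme" and L :: "('l, 'ml) monoid_scheme"
    and \<alpha> :: "'l \<Rightarrow> 'k \<Rightarrow> 'k" and S :: "'k \<Rightarrow> 'l"
  assumes "rel_rota_baxter_group A B \<beta> T"
    and "rel_rota_baxter_group K L \<alpha> S"
  shows "(\<forall>\<nu> \<mu> \<sigma> f. rel_rota_baxter_semidirect_data A B \<beta> T K L \<alpha> S \<nu> \<mu> \<sigma> f \<longrightarrow>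
      rel_rota_baxter_split_extension A B \<beta> T K L \<alpha> S
        (semidirect_group A K \<mu>) (semidirect_group B L \<sigma>)
        (semidirect_action A K \<beta> \<alpha> \<nu> f) (semidirect_operator K T S \<nu>)
        (\<lambda>k. (\<one>\<^bsub>A\<^esub>, k)) (\<lambda>l. (\<one>\<^bsub>B\<^esub>, l)) (\<lambda>(a, k). a) (\<lambda>(b, l). b)) \<and>
    (\<forall>(H :: ('h, 'mh) monoid_scheme) (G :: ('g, 'mg) monoid_scheme) \<phi> R i1 i2 p1 p2.
      rel_rota_baxter_split_extension A B \<beta> T K L \<alpha> S H G \<phi> R i1 i2 p1 p2 \<longrightarrow>
      (\<exists>\<nu> \<mu> \<sigma> f. rel_rota_baxter_semidirect_data A B \<beta> T K L \<alpha> S \<nu> \<mu> \<sigma> f \<and>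
        rel_rota_baxter_equivalent_extensions A B \<beta> T K L \<alpha> S
          H G \<phi> R i1 i2 p1 p2
          (semidirect_group A K \<mu>) (semidirect_group B L \<sigma>)
          (semidirect_action A K \<beta> \<alpha> \<nu> f) (semidirect_operator K T S \<nu>)
          (\<lambda>k. (\<one>\<^bsub>A\<^esub>, k)) (\<lambda>l. (\<one>\<^bsub>B\<^esub>, l)) (\<lambda>(a, k). a) (\<lambda>(b, l). b)))"
proof (intro conjI allI impI)
  fix \<nu> \<mu> \<sigma> f
  assume "rel_rota_baxter_semidirect_data A B \<beta> T K L \<alpha> S \<nu> \<mu> \<sigma> f"
  then show "rel_rota_baxter_split_extension A B \<beta> T K L \<alpha> S
      (semidirect_group A K \<mu>) (semidirect_group B L \<sigma>)
      (semidirect_action A K \<beta> \<alpha> \<nu> f) (semidirect_operator K T S \<nu>)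
      (\<lambda>k. (\<one>\<^bsub>A\<^esub>, k)) (\<lambda>l. (\<one>\<^bsub>B\<^esub>, l)) (\<lambda>(a, k). a) (\<lambda>(b, l). b)"
    by (rule rel_rota_baxter_semidirect_data.rel_rota_baxter_split_extension_semidirect)
next
  fix H :: "('h, 'mh) monoid_scheme" and G :: "('g, 'mg) monoid_scheme" and \<phi> R i1 i2 p1 p2
  assume "rel_rota_baxter_split_extension A B \<beta> T K L \<alpha> S H G \<phi> R i1 i2 p1 p2"
  then interpret E: rel_rota_baxter_split_extension A B \<beta> T K L \<alpha> S H G \<phi> R i1 i2 p1 p2 .
  from E.split obtain sH sG where "rel_rota_baxter_hom A B \<beta> T H G \<phi> R sH sG"
    and "\<forall>a \<in> carrier A. p1 (sH a) = a" "\<forall>b \<in> carrier B. p2 (sG b) = b"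
    by blast
  then interpret rel_rota_baxter_extension_section A B \<beta> T K L \<alpha> S H G \<phi> R i1 i2 p1 p2 sH sG
    by (intro rel_rota_baxter_extension_section.intro E.rel_rota_baxter_extension_axioms
        rel_rota_baxter_extension_section_axioms.intro) auto
  show "\<exists>\<nu> \<mu> \<sigma> f. rel_rota_baxter_semidirect_data A B \<beta> T K L \<alpha> S \<nu> \<mu> \<sigma> f \<and>
      rel_rota_baxter_equivalent_extensions A B \<beta> T K L \<alpha> S
        H G \<phi> R i1 i2 p1 p2
        (semidirect_group A K \<mu>) (semidirect_group B L \<sigma>)
        (semidirect_action A K \<beta> \<alpha> \<nu> f) (semidirect_operator K T S \<nu>)
        (\<lambda>k. (\<one>\<^bsub>A\<^esub>, k)) (\<lambda>l. (\<one>\<^bsub>B\<^esub>, l)) (\<lambda>(a, k). a) (\<lambda>(b, l). b)"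
    \<comment> \<open>The witnesses are \<open>\<nu>\<close>, \<open>H.twist\<close>,
      \<open>G.twist\<close> and \<open>f\<close>, all built from the chosen sections.\<close>
    using semidirect_data equivalent_semidirect by blast
qed

end
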